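(* Let $n\ge 2$. There exists a real Chern-Ricci flat metric on the Hopf manifold $\mathbb S^{2n-1}\times\mathbb S^1$, i.e. a Riemannian metric $g$ compatible with its complex structure $J$ such that $\mathrm{Ric}(\nabla^{\mathrm{Ch},\mathbb R},g)=0$.
   Context: The standard $n$-dimensional Hopf manifold $\mathbb S^{2n-1}\times\mathbb S^1$ ($n\ge2$) is $(\mathbb C^n\setminus\{0\})/G$, where $G$ is the cyclic group generated by $z\mapsto\frac12 z$, with the complex structure $J$ induced from $\mathbb C^n\setminus\{0\}$. For a Hermitian manifold $(M,g,J)$ (that is, $g$ Riemannian, $J$ an integrable complex structure, $g(JX,JY)=g(X,Y)$), put $\omega(X,Y)=g(JX,Y)$ and let $\nabla^{\mathrm{LC}}$ be the Levi-Civita connection. The real Chern connection $\nabla^{\mathrm{Ch},\mathbb R}$ is the unique affine connection on the real tangent bundle $T_{\mathbb R}M$ preserving both $g$ and $J$ whose complexification restricts on $T^{1,0}M$ to the Chern connection. Equivalently, $g(\nabla^{\mathrm{Ch},\mathbb R}_XY,Z)=g(\nabla^{\mathrm{LC}}_XY,Z)-\frac12 d\omega(JX,Y,Z)$. Its curvature is $R^{\mathrm{Ch},\mathbb R}(X,Y,Z,W)=g(\nabla_X\nabla_YZ-\nabla_Y\nabla_XZ-\nabla_{[X,Y]}Z,W)$ with $\nabla=\nabla^{\mathrm{Ch},\mathbb R}$, and $\mathrm{Ric}(\nabla^{\mathrm{Ch},\mathbb R},g)(X,Y)=\sum_{i=1}^{2n}R^{\mathrm{Ch},\mathbb R}(X,e_i,e_i,Y)$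 for a $g$-orthonormal frame $\{e_i\}$. *)

theory Defs
  imports "HOL-Analysis.Analysis"
begin

section \<open>Complex manifolds and Hermitian metrics, in charts\<close>

definition complex_struct :: "complex^'n \<Rightarrow> complex^'n" where
  "complex_struct v = \<i> *s v"

definition holomorphic_map_on :: "(complex^'n \<Rightarrow> complex^'n) \<Rightarrow> (complex^'n) set \<Rightarrow> bool" where
  "holomorphic_map_on f S \<longleftrightarrow> (\<forall>x\<in>S. \<exists>L. (f has_derivative L) (at x) \<and>
     (\<forall>v. L (complex_struct v) = complex_struct (L v)))"

text \<open>A chart is a pair of its domain in the manifold and its coordinate map; the values of the
  coordinate map outside the domain are irrelevant.\<close>

type_synonym ('p, 'n) chart = "'p set \<times> ('p \<Rightarrow> complex^'n)"

definition transition :: "('p, 'n) chart \<Rightarrow> ('p, 'n) chart \<Rightarrow> complex^'n \<Rightarrow> complex^'n" where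
  "transition c d = snd d \<circ> inv_into (fst c) (snd c)"

definition complex_atlas :: "'p set \<Rightarrow> ('p, 'n::finite) chart set \<Rightarrow> bool" where
  "complex_atlas M A \<longleftrightarrow>
     \<Union> (fst ` A) = M \<and>
     (\<forall>c\<in>A. inj_on (snd c) (fst c) \<and> open (snd c ` fst c)) \<and>
     (\<forall>c\<in>A. \<forall>d\<in>A. open (snd c ` (fst c \<inter> fst d)) \<and>
        holomorphic_map_on (transition c d) (snd c ` (fst c \<inter> fst d)))"

primrec Ck_on :: "nat \<Rightarrow> 'a::real_normed_vector set \<Rightarrow> ('a \<Rightarrow> real) \<Rightarrow> bool" where
  "Ck_on 0 S f \<longleftrightarrow> continuous_on S f"
| "Ck_on (Suc k) S f \<longleftrightarrow> (\<forall>x\<in>S. f differentiable (at x)) \<and>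
     (\<forall>v. Ck_on k S (\<lambda>x. frechet_derivative f (at x) v))"

definition smooth_fun_on :: "'a::real_normed_vector set \<Rightarrow> ('a \<Rightarrow> real) \<Rightarrow> bool" where
  "smooth_fun_on S f \<longleftrightarrow> (\<forall>k. Ck_on k S f)"

text \<open>The local expression of a metric: \<open>h x v w\<close> is the value at the point \<open>x\<close> on the tangent
  vectors \<open>v\<close> and \<open>w\<close>.\<close>

type_synonym 'n local_metric = "complex^'n \<Rightarrow> complex^'n \<Rightarrow> complex^'n \<Rightarrow> real"

definition local_hermitian_metric :: "(complex^'n) set \<Rightarrow> 'n local_metric \<Rightarrow> bool" where
  "local_hermitian_metric D h \<longleftrightarrow>
     (\<forall>v w. smooth_fun_on D (\<lambda>x. h x v w)) \<and>
     (\<forall>x\<in>D. bilinear (h x) \<and>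
        (\<forall>v w. h x v w = h x w v) \<and>
        (\<forall>v. v \<noteq> 0 \<longrightarrow> h x v v > 0) \<and>
        (\<forall>v w. h x (complex_struct v) (complex_struct w) = h x v w))"

text \<open>A Riemannian metric on a manifold, compatible with the complex structure, is a family of local
  expressions, one for each chart of the atlas, related by the transformation law of covariant
  2-tensors.  Since the transition maps are holomorphic, the complex structure of the manifold is
  multiplication by \<open>\<i>\<close> in every chart.\<close>

definition hermitian_metric ::
    "('p, 'n::finite) chart set \<Rightarrow> (('p, 'n) chart \<Rightarrow> 'n local_metric) \<Rightarrow> bool" where
  "hermitian_metric A g \<longleftrightarrow>
     (\<forall>c\<in>A. local_hermitian_metric (snd c ` fst c) (g c)) \<and>
     (\<forall>c\<in>A. \<forall>d\<in>A. \<forall>x \<in> snd c ` (fst c \<inter> fst d). \<forall>v w.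
        g c x v w = g d (transition c d x)
          (frechet_derivative (transition c d) (at x) v)
          (frechet_derivative (transition c d) (at x) w))"

section \<open>The real Chern connection and its Ricci curvature\<close>

text \<open>Connections on a chart are given by their Christoffel maps: \<open>\<Gamma> x u v\<close> is the covariant
  derivative, at \<open>x\<close> and in direction \<open>u\<close>, of the constant vector field \<open>v\<close>.\<close>

type_synonym 'n christoffel = "complex^'n \<Rightarrow> complex^'n \<Rightarrow> complex^'n \<Rightarrow> complex^'n"

type_synonym 'n vfield = "complex^'n \<Rightarrow> complex^'n"

definition cov_deriv :: "'n::finite christoffel \<Rightarrow> 'n vfield \<Rightarrow> 'n vfield \<Rightarrow> 'n vfield" where
  "cov_deriv \<Gamma> X Y = (\<lambda>x. frechet_derivative Y (at x) (X x) + \<Gamma> x (X x) (Y x))"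

definition lie_bracket :: "'n::finite vfield \<Rightarrow> 'n vfield \<Rightarrow> 'n vfield" where
  "lie_bracket X Y = (\<lambda>x. frechet_derivative Y (at x) (X x) - frechet_derivative X (at x) (Y x))"

text \<open>The Levi-Civita connection is the unique torsion-free connection preserving the metric.\<close>

definition levi_civita :: "'n::finite local_metric \<Rightarrow> 'n christoffel" where
  "levi_civita h x = (THE \<Gamma>. bilinear \<Gamma> \<and>
     (\<forall>u v. \<Gamma> u v = \<Gamma> v u) \<and>
     (\<forall>u v w. frechet_derivative (\<lambda>y. h y v w) (at x) u = h x (\<Gamma> u v) w + h x v (\<Gamma> u w)))"

definition fundamental_form :: "'n::finite local_metric \<Rightarrow> 'n local_metric" where
  "fundamental_form h x v w = h x (complex_struct v) w"

text \<open>The exterior derivative of a 2-form, evaluated on constant vector fields; no factor \<open>1/3\<close>.\<close>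

definition ext_deriv2 ::
    "'n local_metric \<Rightarrow> complex^'n \<Rightarrow> complex^'n \<Rightarrow> complex^'n \<Rightarrow> complex^'n \<Rightarrow> real" where
  "ext_deriv2 \<omega> x u v w =
     frechet_derivative (\<lambda>y. \<omega> y v w) (at x) u +
     frechet_derivative (\<lambda>y. \<omega> y w u) (at x) v +
     frechet_derivative (\<lambda>y. \<omega> y u v) (at x) w"

text \<open>The real Chern connection is determined by
  \<open>g(\<nabla>\<^sup>C\<^sup>h\<^sub>X Y, Z) = g(\<nabla>\<^sup>L\<^sup>C\<^sub>X Y, Z) - 1/2 d\<omega>(JX, Y, Z)\<close>; the two covariant derivatives have the same
  first-order part, so that this is an equation between their Christoffel maps.\<close>

definition real_chern :: "'n::finite local_metric \<Rightarrow> 'n christoffel" where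
  "real_chern h x u v = (THE a. \<forall>w. h x a w =
     h x (levi_civita h x u v) w - 1/2 * ext_deriv2 (fundamental_form h) x (complex_struct u) v w)"

definition curvature ::
    "'n local_metric \<Rightarrow> 'n christoffel \<Rightarrow> 'n vfield \<Rightarrow> 'n vfield \<Rightarrow> 'n vfield \<Rightarrow> 'n vfield
      \<Rightarrow> complex^'n \<Rightarrow> real" where
  "curvature h \<Gamma> X Y Z W = (\<lambda>x. h x
     (cov_deriv \<Gamma> X (cov_deriv \<Gamma> Y Z) x - cov_deriv \<Gamma> Y (cov_deriv \<Gamma> X Z) x
        - cov_deriv \<Gamma> (lie_bracket X Y) Z x) (W x))"

text \<open>The curvature is tensorial, so its value on tangent vectors at a point is computed from their
  extensions to constant vector fields.\<close>

definition curvature_at ::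
    "'n local_metric \<Rightarrow> 'n christoffel \<Rightarrow> complex^'n \<Rightarrow>
      complex^'n \<Rightarrow> complex^'n \<Rightarrow> complex^'n \<Rightarrow> complex^'n \<Rightarrow> real" where
  "curvature_at h \<Gamma> x u v w z = curvature h \<Gamma> (\<lambda>_. u) (\<lambda>_. v) (\<lambda>_. w) (\<lambda>_. z) x"

definition orthonormal_frame ::
    "'n local_metric \<Rightarrow> complex^'n \<Rightarrow> (nat \<Rightarrow> complex^'n) \<Rightarrow> bool" where
  "orthonormal_frame h x e \<longleftrightarrow>
     (\<forall>i < 2 * CARD('n). \<forall>j < 2 * CARD('n). h x (e i) (e j) = (if i = j then 1 else 0))"

definition ricci ::
    "'n local_metric \<Rightarrow> 'n christoffel \<Rightarrow> complex^'n \<Rightarrow> (nat \<Rightarrow> complex^'n) \<Rightarrow>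
      complex^'n \<Rightarrow> complex^'n \<Rightarrow> real" where
  "ricci h \<Gamma> x e u v = (\<Sum>i < 2 * CARD('n). curvature_at h \<Gamma> x u (e i) (e i) v)"

definition real_chern_ricci_flat ::
    "('p, 'n::finite) chart set \<Rightarrow> (('p, 'n) chart \<Rightarrow> 'n local_metric) \<Rightarrow> bool" where
  "real_chern_ricci_flat A g \<longleftrightarrow>
     (\<forall>c\<in>A. \<forall>x \<in> snd c ` fst c. \<forall>e. orthonormal_frame (g c) x e \<longrightarrow>
        (\<forall>u v. ricci (g c) (real_chern (g c)) x e u v = 0))"

section \<open>The standard Hopf manifold\<close>

text \<open>The points are the orbits of the nonzero vectors under the cyclic group generated by
  \<open>z \<mapsto> z/2\<close>; the charts are the inverses of the projection on the open sets on which it is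
  injective.\<close>

definition hopf_orbit :: "complex^'n \<Rightarrow> (complex^'n) set" where
  "hopf_orbit z = {((1/2) powi k) *\<^sub>R z | k :: int. True}"

definition hopf_manifold :: "(complex^'n) set set" where
  "hopf_manifold = hopf_orbit ` (UNIV - {0})"

definition hopf_atlas :: "((complex^'n) set, 'n) chart set" where
  "hopf_atlas = {(hopf_orbit ` V, inv_into V hopf_orbit) | V.
     open V \<and> V \<subseteq> UNIV - {0} \<and> inj_on hopf_orbit V}"

lemma hopf_orbit_eq_iff:
  "hopf_orbit z = hopf_orbit w \<longleftrightarrow> (\<exists>k::int. w = ((1/2) powi k) *\<^sub>R z)"
proof
  assume "hopf_orbit z = hopf_orbit w"
  moreover have "w \<in> hopf_orbit w"
    unfolding hopf_orbit_def by (auto intro!: exI[of _ 0])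
  ultimately show "\<exists>k::int. w = ((1/2) powi k) *\<^sub>R z"
    unfolding hopf_orbit_def by auto
next
  assume "\<exists>k::int. w = ((1/2) powi k) *\<^sub>R z"
  then obtain k :: int where k: "w = ((1/2) powi k) *\<^sub>R z" by blast
  have pow: "((1/2::real) powi l) * ((1/2) powi m) = (1/2) powi (l + m)" for l m :: int
    by (simp add: power_int_add)
  show "hopf_orbit z = hopf_orbit w"
  proof (intro set_eqI iffI)
    fix y assume "y \<in> hopf_orbit z"
    then obtain l :: int where "y = ((1/2) powi l) *\<^sub>R z"
      unfolding hopf_orbit_def by blast
    then have "y = ((1/2) powi (l - k)) *\<^sub>R w"
      by (simp add: k pow)
    then show "y \<in> hopf_orbit w"
      unfolding hopf_orbit_def by blast
  next
    fix y assume "y \<in> hopf_orbit w"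
    then obtain l :: int where "y = ((1/2) powi l) *\<^sub>R w"
      unfolding hopf_orbit_def by blast
    then have "y = ((1/2) powi (l + k)) *\<^sub>R z"
      by (simp add: k pow)
    then show "y \<in> hopf_orbit z"
      unfolding hopf_orbit_def by blast
  qed
qed

lemma hopf_orbit_locally_inj:
  fixes z :: "complex^'n"
  assumes "z \<noteq> 0"
  obtains V where "open V" "z \<in> V" "V \<subseteq> UNIV - {0}" "inj_on hopf_orbit V"
proof
  define r where "r = norm z"
  have r: "r > 0" using assms by (simp add: r_def)
  define V where "V = {y::complex^'n. 3/4 * r < norm y \<and> norm y < 5/4 * r}"
  have "open {y::complex^'n. 3/4 * r < norm y}" "open {y::complex^'n. norm y < 5/4 * r}"
    by (intro open_Collect_less continuous_intros)+
  then show "open V"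
    unfolding V_def by (simp add: Collect_conj_eq open_Int)
  show "z \<in> V" using r by (simp add: V_def r_def)
  show "V \<subseteq> UNIV - {0}" using r by (auto simp: V_def)
  show "inj_on hopf_orbit V"
  proof (rule inj_onI)
    fix x y assume xy: "x \<in> V" "y \<in> V" "hopf_orbit x = hopf_orbit y"
    then obtain k :: int where k: "y = ((1/2) powi k) *\<^sub>R x"
      using hopf_orbit_eq_iff by blast
    then have n: "norm y = ((1/2) powi k) * norm x" by simp
    have *: "k \<le> 0"
    proof (rule ccontr)
      assume "\<not> k \<le> 0"
      then have "((1/2::real) powi k) \<le> (1/2) powi 1"
        by (intro power_int_decreasing) auto
      then have "norm y \<le> 1/2 * norm x" unfolding n by (intro mult_right_mono) auto
      with xy r show False by (simp add: V_def)
    qed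
    have **: "k \<ge> 0"
    proof (rule ccontr)
      assume "\<not> k \<ge> 0"
      then have "((1/2::real) powi (-1)) \<le> (1/2) powi k"
        by (intro power_int_decreasing) auto
      then have "2 * norm x \<le> norm y" unfolding n by (intro mult_right_mono) auto
      with xy r show False by (simp add: V_def)
    qed
    from * ** k show "x = y" by simp
  qed
qed

lemma complex_atlas_hopf:
  "complex_atlas hopf_manifold (hopf_atlas :: ((complex^'n) set, 'n) chart set)"
  unfolding complex_atlas_def
proof (intro conjI ballI)
  let ?A = "hopf_atlas :: ((complex^'n) set, 'n) chart set"
  show "\<Union> (fst ` ?A) = hopf_manifold"
  proof
    show "\<Union> (fst ` ?A) \<subseteq> hopf_manifold"
      unfolding hopf_atlas_def hopf_manifold_def by (auto 0 3 intro!: imageI)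
    show "hopf_manifold \<subseteq> \<Union> (fst ` ?A)"
    proof
      fix p :: "(complex^'n) set" assume "p \<in> hopf_manifold"
      then obtain z where z: "z \<noteq> 0" "p = hopf_orbit z" unfolding hopf_manifold_def by blast
      obtain V where V: "open V" "z \<in> V" "V \<subseteq> UNIV - {0}" "inj_on hopf_orbit V"
        using hopf_orbit_locally_inj[OF z(1)] .
      then have "(hopf_orbit ` V, inv_into V hopf_orbit) \<in> ?A"
        unfolding hopf_atlas_def by blast
      then show "p \<in> \<Union> (fst ` ?A)" using z V by force
    qed
  qed
  fix c assume "c \<in> ?A"
  then obtain V where V: "open V" "V \<subseteq> UNIV - {0}" "inj_on hopf_orbit V"
      and c: "c = (hopf_orbit ` V, inv_into V hopf_orbit)"
    unfolding hopf_atlas_def by blast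
  have im: "inv_into V hopf_orbit ` hopf_orbit ` V = V"
    using V(3) by (auto simp: image_image inv_into_f_f)
  show inj: "inj_on (snd c) (fst c)" by (simp add: c inj_on_inv_into)
  show "open (snd c ` fst c)" by (simp add: c im V)
  fix d assume "d \<in> ?A"
  then obtain W where W: "open W" "W \<subseteq> UNIV - {0}" "inj_on hopf_orbit W"
      and d: "d = (hopf_orbit ` W, inv_into W hopf_orbit)"
    unfolding hopf_atlas_def by blast
  define S where "S = snd c ` (fst c \<inter> fst d)"
  define sc where "sc = (\<lambda>k (x::complex^'n). ((1/2::real) powi (k::int)) *\<^sub>R x)"
  have cont: "continuous_on UNIV (sc k)" for k
    unfolding sc_def by (intro continuous_intros)
  have S1: "x \<in> V \<and> (\<exists>k. sc k x \<in> W)" if "x \<in> S" for x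
  proof -
    from that obtain y w where yw: "y \<in> V" "w \<in> W" "hopf_orbit y = hopf_orbit w"
      "x = inv_into V hopf_orbit (hopf_orbit y)"
      unfolding S_def c d by auto
    then have "x = y" using V inv_into_f_f by metis
    with yw show ?thesis unfolding sc_def hopf_orbit_eq_iff by auto
  qed
  have S2: "x \<in> S" if "x \<in> V" "sc k x \<in> W" for x k
  proof -
    have "hopf_orbit x = hopf_orbit (sc k x)"
      unfolding hopf_orbit_eq_iff sc_def by blast
    then have "hopf_orbit x \<in> fst c \<inter> fst d" using that by (auto simp: c d)
    moreover have "x = snd c (hopf_orbit x)" using that V by (simp add: c inv_into_f_f)
    ultimately show ?thesis unfolding S_def by (rule rev_image_eqI)
  qed
  have Seq: "S = (\<Union>k. V \<inter> sc k -` W)"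
  proof (intro set_eqI iffI)
    fix x assume "x \<in> S"
    then show "x \<in> (\<Union>k. V \<inter> sc k -` W)" using S1[of x] by simp
  next
    fix x assume "x \<in> (\<Union>k. V \<inter> sc k -` W)"
    then show "x \<in> S" using S2[of x] by auto
  qed
  have op: "open (V \<inter> sc k -` W)" for k
    using V W cont by (intro open_Int open_vimage) auto
  then show "open (snd c ` (fst c \<inter> fst d))"
    unfolding S_def[symmetric] Seq by (intro open_UN) simp
  have tr: "transition c d x = sc k x" if "x \<in> V" "sc k x \<in> W" for x k
  proof -
    have "inv_into (fst c) (snd c) (snd c (hopf_orbit x)) = hopf_orbit x"
      using inj that by (intro inv_into_f_f) (auto simp: c)
    then have "inv_into (fst c) (snd c) x = hopf_orbit x"
      using that V by (simp add: c inv_into_f_f)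
    also have "\<dots> = hopf_orbit (sc k x)"
      unfolding hopf_orbit_eq_iff sc_def by blast
    finally show ?thesis using that W by (simp add: transition_def d inv_into_f_f)
  qed
  show "holomorphic_map_on (transition c d) (snd c ` (fst c \<inter> fst d))"
    unfolding S_def[symmetric] holomorphic_map_on_def
  proof
    fix x assume "x \<in> S"
    then obtain k where k: "x \<in> V \<inter> sc k -` W" unfolding Seq by (rule UN_E)
    have "(sc k has_derivative sc k) (at x)"
      unfolding sc_def by (auto intro!: derivative_eq_intros)
    then have "(transition c d has_derivative sc k) (at x)"
      by (rule has_derivative_transform_within_open[OF _ op k]) (auto simp: tr)
    moreover have "sc k (complex_struct v) = complex_struct (sc k v)" for v
      by (simp add: sc_def complex_struct_def vec_eq_iff)
    ultimately show "\<exists>L. (transition c d has_derivative L) (at x) \<and>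
        (\<forall>v. L (complex_struct v) = complex_struct (L v))" by blast
  qed
qed

end

theory Submission
  imports Defs
begin

text \<open>For \<open>t > 0\<close> the metric with components
  \<open>h\<^sub>k\<^sub>l = t \<delta>\<^sub>k\<^sub>l / |z|\<^sup>2 + cnj z\<^sub>k z\<^sub>l / |z|\<^sup>4\<close> on the punctured space is invariant under scaling, hence
  descends to the Hopf manifold.  Its Chern connection has Christoffel map
  \<open>\<Gamma>(u, v) = - \<zeta>(u) v + 1/t \<zeta>(v) (u - \<zeta>(u) z)\<close> with \<open>\<zeta>(u) = (u, z) / |z|\<^sup>2\<close>, and the only curvature is the
  derivative of \<open>\<Gamma>\<close> in the conjugate directions.  Tracing it over an orthonormal frame gives
  \<open>2/t (1 - (n - 1)/t)\<close> times the part of the metric that is transversal to the complex line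
  through \<open>z\<close>, which vanishes for \<open>t = n - 1\<close>.\<close>

section \<open>Linear algebra of the complex structure\<close>

abbreviation J :: "complex^'n \<Rightarrow> complex^'n" where "J \<equiv> complex_struct"

lemma bounded_linear_complex_struct: "bounded_linear (J :: complex^'n \<Rightarrow> complex^'n::finite)"
  unfolding linear_conv_bounded_linear[symmetric]
  by (rule linearI) (simp_all add: complex_struct_def vec_eq_iff algebra_simps)

lemmas complex_struct_linear [simp] =
  linear_add[OF bounded_linear.linear[OF bounded_linear_complex_struct]]
  linear_scale[OF bounded_linear.linear[OF bounded_linear_complex_struct]]
  linear_neg[OF bounded_linear.linear[OF bounded_linear_complex_struct]]
  linear_diff[OF bounded_linear.linear[OF bounded_linear_complex_struct]]
  linear_0[OF bounded_linear.linear[OF bounded_linear_complex_struct]]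

lemmas has_derivative_complex_struct [derivative_intros] =
  bounded_linear.has_derivative[OF bounded_linear_complex_struct]

lemma complex_struct_complex_struct [simp]: "J (J v) = - v"
  by (simp add: complex_struct_def vec_eq_iff)

lemma inner_complex_struct_left [simp]:
  fixes v w :: "complex^'n::finite"
  shows "inner (J v) w = - inner v (J w)"
  unfolding inner_vec_def sum_negf[symmetric]
  by (rule sum.cong) (simp_all add: complex_struct_def inner_complex_def)

lemma inner_complex_struct_commute:
  fixes v w :: "complex^'n::finite"
  shows "inner v (J w) = - inner w (J v)"
  by (metis inner_commute inner_complex_struct_left)

lemma inner_complex_struct_same [simp]: "inner x (J x) = (0::real)" for x :: "complex^'n::finite"
  using inner_complex_struct_commute[of x x] by simp

section \<open>Smooth functions\<close>

text \<open>Induction on \<open>k\<close>: if the directional derivatives of members are again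
  members on \<open>S\<close>, one degree of differentiability can be gained indefinitely.\<close>

lemma Ck_on_family:
  assumes "open S" and "f \<in> F"
    and diff: "\<And>f x. f \<in> F \<Longrightarrow> x \<in> S \<Longrightarrow> f differentiable (at x)"
    and deriv: "\<And>f v. f \<in> F \<Longrightarrow> \<exists>g\<in>F. \<forall>x\<in>S. frechet_derivative f (at x) v = g x"
  shows "Ck_on k S f"
proof -
  \<comment> \<open>A derivative agrees with a member of \<open>F\<close> only on \<open>S\<close>,
    since its values elsewhere are uncontrolled. The induction therefore runs over all functions
    that agree with a member on \<open>S\<close>.\<close>
  have "Ck_on k S g" if "f \<in> F" "\<And>x. x \<in> S \<Longrightarrow> g x = f x" for f g
    using that
  proof (induction k arbitrary: f g)
    case 0
    have "continuous_on S f"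
      by (intro continuous_at_imp_continuous_on ballI differentiable_imp_continuous_within diff[OF 0(1)])
    moreover have "continuous_on S g = continuous_on S f"
      by (rule continuous_on_cong) (simp_all add: 0(2))
    ultimately show ?case by simp
  next
    case (Suc k)
    have gd: "(g has_derivative frechet_derivative f (at x)) (at x)" if "x \<in> S" for x
      by (rule has_derivative_transform_within_open
          [OF iffD1[OF frechet_derivative_works diff[OF Suc.prems(1) that]] \<open>open S\<close> that])
         (simp add: Suc.prems(2))
    have "Ck_on k S (\<lambda>x. frechet_derivative g (at x) v)" for v
    proof -
      obtain f' where f': "f' \<in> F" "\<forall>x\<in>S. frechet_derivative f (at x) v = f' x"
        using deriv[OF Suc.prems(1)] by blast
      have "frechet_derivative g (at x) v = f' x" if "x \<in> S" for x
        using f'(2) that by (simp flip: frechet_derivative_at[OF gd[OF that]])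
      then show ?thesis by (rule Suc.IH[OF f'(1)])
    qed
    moreover have "\<forall>x\<in>S. g differentiable (at x)"
      using gd differentiableI by blast
    ultimately show ?case by simp
  qed
  then show ?thesis using \<open>f \<in> F\<close> by blast
qed

text \<open>A class large enough to contain the coefficients of the metric and, away from the
  origin, closed under directional derivatives.\<close>

inductive_set radial_rational :: "('a::real_inner \<Rightarrow> real) set" where
  const: "(\<lambda>x. c) \<in> radial_rational"
| linear: "(\<lambda>x. inner x v) \<in> radial_rational"
| inv: "(\<lambda>x. inverse (inner x x)) \<in> radial_rational"
| add: "f \<in> radial_rational \<Longrightarrow> g \<in> radial_rational \<Longrightarrow> (\<lambda>x. f x + g x) \<in> radial_rational"
| mult: "f \<in> radial_rational \<Longrightarrow> g \<in> radial_rational \<Longrightarrow> (\<lambda>x. f x * g x) \<in> radial_rational"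

lemma has_derivative_inverse_inner_self:
  assumes "x \<noteq> (0::'a::real_inner)"
  shows "((\<lambda>x. inverse (inner x x)) has_derivative
      (\<lambda>u. - 2 * inner x u * (inverse (inner x x))\<^sup>2)) (at x)"
  by (rule has_derivative_eq_rhs[OF Deriv.has_derivative_inverse[OF _
        has_derivative_inner[OF has_derivative_ident has_derivative_ident]]])
     (use assms in \<open>simp_all add: fun_eq_iff inner_commute power2_eq_square\<close>)

lemma radial_rational_derivative:
  assumes "f \<in> radial_rational"
  shows "\<exists>f'. (\<forall>v. (\<lambda>x. f' x v) \<in> radial_rational) \<and>
    (\<forall>x. x \<noteq> 0 \<longrightarrow> (f has_derivative f' x) (at x))"
  using assms
proof induction
  case (const c)
  show ?case
    by (rule exI[of _ "\<lambda>_ _. 0"]) (simp add: radial_rational.const)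
next
  case (linear w)
  show ?case
    by (rule exI[of _ "\<lambda>x v. inner v w"])
       (simp add: radial_rational.const
          bounded_linear.has_derivative[OF bounded_linear_inner_left has_derivative_ident])
next
  case inv
  show ?case
  proof (intro exI conjI allI impI)
    show "(\<lambda>x. (-2) * inner x v * inverse (inner x x) * inverse (inner x x)) \<in> radial_rational"
      for v :: 'a
      by (intro radial_rational.intros)
    show "((\<lambda>x. inverse (inner x x)) has_derivative
        (\<lambda>v. (-2) * inner x v * inverse (inner x x) * inverse (inner x x))) (at x)"
      if "x \<noteq> 0" for x :: 'a
      by (rule has_derivative_eq_rhs[OF has_derivative_inverse_inner_self[OF that]])
         (simp add: power2_eq_square mult.assoc)
  qed
next
  case (add f g)
  then obtain f' g' where "\<And>v. (\<lambda>x. f' x v) \<in> radial_rational" "\<And>v. (\<lambda>x. g' x v) \<in> radial_rational"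
    and d: "\<And>x. x \<noteq> 0 \<Longrightarrow> (f has_derivative f' x) (at x)" "\<And>x. x \<noteq> 0 \<Longrightarrow> (g has_derivative g' x) (at x)"
    by metis
  then have "(\<lambda>x. f' x v + g' x v) \<in> radial_rational" for v
    by (intro radial_rational.add)
  then show ?case
    using has_derivative_add[OF d] by (intro exI[of _ "\<lambda>x v. f' x v + g' x v"] conjI allI impI)
next
  case (mult f g)
  then obtain f' g' where "\<And>v. (\<lambda>x. f' x v) \<in> radial_rational" "\<And>v. (\<lambda>x. g' x v) \<in> radial_rational"
    and d: "\<And>x. x \<noteq> 0 \<Longrightarrow> (f has_derivative f' x) (at x)" "\<And>x. x \<noteq> 0 \<Longrightarrow> (g has_derivative g' x) (at x)"
    by metis
  then have "(\<lambda>x. f x * g' x v + f' x v * g x) \<in> radial_rational" for v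
    by (intro radial_rational.add radial_rational.mult mult.hyps)
  then show ?case
    using has_derivative_mult[OF d]
    by (intro exI[of _ "\<lambda>x v. f x * g' x v + f' x v * g x"] conjI allI impI)
qed

lemma smooth_fun_on_radial_rational:
  assumes "f \<in> radial_rational" "open S" "0 \<notin> S"
  shows "smooth_fun_on S f"
  unfolding smooth_fun_on_def
proof
  fix k
  show "Ck_on k S f"
  proof (rule Ck_on_family[OF \<open>open S\<close> \<open>f \<in> radial_rational\<close>])
    show "f differentiable (at x)" if "f \<in> radial_rational" "x \<in> S" for f :: "'a \<Rightarrow> real" and x
      using radial_rational_derivative[OF that(1)] that(2) \<open>0 \<notin> S\<close> by (metis differentiableI)
    show "\<exists>g\<in>radial_rational. \<forall>x\<in>S. frechet_derivative f (at x) v = g x"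
      if f: "f \<in> radial_rational" for f :: "'a \<Rightarrow> real" and v
    proof -
      obtain f' where f': "\<forall>v. (\<lambda>x. f' x v) \<in> radial_rational"
        "\<forall>x. x \<noteq> 0 \<longrightarrow> (f has_derivative f' x) (at x)"
        using radial_rational_derivative[OF f] by blast
      have "frechet_derivative f (at x) v = f' x v" if "x \<in> S" for x
      proof -
        have "(f has_derivative f' x) (at x)" using f'(2) that \<open>0 \<notin> S\<close> by metis
        from frechet_derivative_at[OF this] show ?thesis by simp
      qed
      then show ?thesis using f'(1) by (intro bexI[of _ "\<lambda>x. f' x v"]) auto
    qed
  qed
qed

section \<open>The Chern connection of a Hermitian metric\<close>

text \<open>Riesz representation: the map \<open>T\<close> that carries \<open>B\<close> to the
  Euclidean product is injective by positivity, hence surjective in finite dimension. It supplies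
  the existence half of the definite descriptions of the connections.\<close>

lemma positive_form_representation:
  fixes B :: "'a::euclidean_space \<Rightarrow> 'a \<Rightarrow> real"
  assumes B: "bilinear B" and pos: "\<And>v. v \<noteq> 0 \<Longrightarrow> B v v > 0" and \<phi>: "linear \<phi>"
  obtains a where "\<And>w. B a w = \<phi> w"
proof -
  define T where "T v = (\<Sum>b\<in>Basis. B v b *\<^sub>R b)" for v
  have lin: "linear (B v)" "linear (\<lambda>v. B v w)" for v w
    using B by (auto simp: bilinear_def)
  have T: "inner (T v) w = B v w" for v w
  proof -
    have "B v w = B v (\<Sum>b\<in>Basis. inner w b *\<^sub>R b)" by (simp add: euclidean_representation)
    also have "\<dots> = (\<Sum>b\<in>Basis. inner w b * B v b)"
      by (simp add: linear_sum[OF lin(1)] linear_scale[OF lin(1)])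
    finally show ?thesis
      by (simp add: T_def inner_sum_left inner_commute[of w] mult.commute)
  qed
  have "linear T"
    by (rule linearI)
       (simp_all add: T_def linear_add[OF lin(2)] linear_scale[OF lin(2)] algebra_simps
          sum.distrib scaleR_sum_right)
  moreover have "inj T"
    unfolding linear_injective_0[OF \<open>linear T\<close>]
    by (metis T inner_zero_left less_irrefl pos)
  ultimately have "surj T" by (intro linear_injective_imp_surjective) auto
  then obtain a where a: "T a = (\<Sum>b\<in>Basis. \<phi> b *\<^sub>R b)" by (metis surjD)
  have "B a w = \<phi> w" for w
  proof -
    have "\<phi> w = \<phi> (\<Sum>b\<in>Basis. inner w b *\<^sub>R b)" by (simp add: euclidean_representation)
    also have "\<dots> = (\<Sum>b\<in>Basis. inner w b * \<phi> b)"
      by (simp add: linear_sum[OF \<phi>] linear_scale[OF \<phi>])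
    finally show ?thesis
      by (simp add: a inner_sum_left inner_commute[of w] mult.commute flip: T)
  qed
  then show thesis by (rule that)
qed

text \<open>Nondegeneracy, by testing on \<open>a - b\<close>; it supplies the uniqueness
  half.\<close>

lemma positive_form_cancel:
  fixes B :: "'a::real_vector \<Rightarrow> 'a \<Rightarrow> real"
  assumes "bilinear B" "\<And>v. v \<noteq> 0 \<Longrightarrow> B v v > 0" "\<And>w. B a w = B b w"
  shows "a = b"
proof -
  have "B (a - b) (a - b) = 0" using assms(3) by (simp add: bilinear_lsub[OF assms(1)])
  then show ?thesis using assms(2)[of "a - b"] by force
qed

locale hermitian_at =
  fixes h :: "'n::finite local_metric" and S x
  assumes metric: "local_hermitian_metric S h" and S: "open S" "x \<in> S"
begin

definition D :: "complex^'n \<Rightarrow> complex^'n \<Rightarrow> complex^'n \<Rightarrow> real" where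
  "D u v w = frechet_derivative (\<lambda>y. h y v w) (at x) u"

lemma D_works: "((\<lambda>y. h y v w) has_derivative (\<lambda>u. D u v w)) (at x)"
proof -
  have "Ck_on (Suc 0) S (\<lambda>y. h y v w)"
    using metric unfolding local_hermitian_metric_def smooth_fun_on_def by blast
  then show ?thesis using S unfolding D_def by (simp add: frechet_derivative_works[symmetric])
qed

text \<open>Uniqueness of derivatives. It transfers the algebraic symmetries of \<open>h\<close> on
  \<open>S\<close> to \<open>D\<close>, and later identifies \<open>D\<close> for the explicit
  metric.\<close>

lemma D_eqI:
  assumes "(f has_derivative (\<lambda>u. F u)) (at x)" "\<And>y. y \<in> S \<Longrightarrow> f y = h y v w"
  shows "D u v w = F u"
  using has_derivative_transform_within_open[OF assms(1) S assms(2)]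
    has_derivative_unique[OF D_works] by metis

lemma bil: "y \<in> S \<Longrightarrow> bilinear (h y)"
  and sym: "y \<in> S \<Longrightarrow> h y v w = h y w v"
  and pos: "y \<in> S \<Longrightarrow> v \<noteq> 0 \<Longrightarrow> h y v v > 0"
  and herm: "y \<in> S \<Longrightarrow> h y (J v) (J w) = h y v w"
  using metric unfolding local_hermitian_metric_def by blast+

lemma D_linear: "linear (\<lambda>u. D u v w)"
  using D_works has_derivative_linear by blast

lemma D_sym: "D u v w = D u w v"
  by (rule D_eqI[OF D_works]) (simp add: sym)

lemma D_herm: "D u (J v) (J w) = D u v w"
  by (rule D_eqI[OF D_works]) (simp add: herm)

lemma D_add: "D u (v + v') w = D u v w + D u v' w"
  by (rule D_eqI[OF has_derivative_add[OF D_works D_works]]) (simp add: bilinear_ladd bil)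

lemma D_scale: "D u (c *\<^sub>R v) w = c * D u v w"
  by (rule D_eqI[OF has_derivative_mult_right[OF D_works]])
     (simp add: bilinear_lmul bil)

lemma D_bilinear: "bilinear (D u)"
  unfolding bilinear_def
  by (auto intro!: linearI simp: D_add D_scale D_sym[of u v "_ + _" for v] D_sym[of u v "_ *\<^sub>R _" for v])
     (simp_all add: D_sym)

lemmas D_lin = linear_add[OF D_linear] linear_scale[OF D_linear] linear_neg[OF D_linear]
  bilinear_ladd[OF D_bilinear] bilinear_lmul[OF D_bilinear] bilinear_lneg[OF D_bilinear]
  bilinear_radd[OF D_bilinear] bilinear_rmul[OF D_bilinear] bilinear_rneg[OF D_bilinear]

text \<open>The Koszul formula on constant fields, whose brackets vanish. The representation lemma
  yields a candidate \<open>G\<close>, and the formula forces every connection with the defining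
  properties to equal it.\<close>

lemma koszul:
  "h x (levi_civita h x u v) w = 1/2 * (D u v w + D v u w - D w u v)"
proof -
  let ?K = "\<lambda>u v w. 1/2 * (D u v w + D v u w - D w u v)"
  have "\<exists>a. \<forall>w. h x a w = ?K u v w" for u v
  proof -
    have "linear (?K u v)"
      by (rule linearI) (simp_all add: D_lin algebra_simps)
    from positive_form_representation[OF bil[OF S(2)] pos[OF S(2)] this] show ?thesis
      by metis
  qed
  then obtain G where G: "\<And>u v w. h x (G u v) w = ?K u v w" by metis
  note cancel = positive_form_cancel[OF bil[OF S(2)] pos[OF S(2)]]
  note blin = bilinear_ladd[OF bil[OF S(2)]] bilinear_lmul[OF bil[OF S(2)]]
  let ?P = "\<lambda>\<Gamma>. bilinear \<Gamma> \<and> (\<forall>u v. \<Gamma> u v = \<Gamma> v u) \<and>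
     (\<forall>u v w. D u v w = h x (\<Gamma> u v) w + h x v (\<Gamma> u w))"
  have PG: "?P G"
  proof (intro conjI allI)
    show "bilinear G"
      unfolding bilinear_def
      by (auto intro!: linearI cancel simp: G blin) (simp_all add: D_lin field_simps)
    show "G u v = G v u" for u v
      by (rule cancel) (simp_all add: G D_sym)
    show "D u v w = h x (G u v) w + h x v (G u w)" for u v w
      using D_sym[of u v w] D_sym[of v u w] D_sym[of w u v]
      by (simp add: G sym[OF S(2), of v] field_simps)
  qed
  \<comment> \<open>Compatibility for \<open>(u, v, w)\<close> plus that for
    \<open>(v, u, w)\<close> minus that for \<open>(w, u, v)\<close>; by symmetry of
    \<open>\<Gamma>\<close> all but twice the wanted term cancels.\<close>
  have K: "h x (\<Gamma> u v) w = ?K u v w" if "?P \<Gamma>" for \<Gamma> u v w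
  proof -
    have s: "\<Gamma> v u = \<Gamma> u v" "\<Gamma> w u = \<Gamma> u w" "\<Gamma> w v = \<Gamma> v w" using that by blast+
    have "D u v w = h x (\<Gamma> u v) w + h x v (\<Gamma> u w)"
      "D v u w = h x (\<Gamma> v u) w + h x u (\<Gamma> v w)"
      "D w u v = h x (\<Gamma> w u) v + h x u (\<Gamma> w v)" using that by blast+
    then show ?thesis
      using sym[OF S(2), of v "\<Gamma> u w"] by (simp add: s)
  qed
  have "\<Gamma> = G" if "?P \<Gamma>" for \<Gamma>
    by (intro ext cancel) (simp_all add: K[OF that] K[OF PG])
  then have "levi_civita h x = G"
    unfolding levi_civita_def D_def[symmetric] using PG by (intro the_equality) blast+
  then show ?thesis by (simp add: G)
qed

text \<open>The right-hand side is the real form of \<open>\<partial>\<^sub>u h\<close>: in holomorphic coordinates the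
  Christoffel symbols of the Chern connection are \<open>h\<^sup>-\<^sup>1 \<partial>h\<close>.\<close>

lemma real_chern_eqI:
  assumes "\<And>w. h x a w = 1/2 * (D u v w - D (J u) (J v) w)"
  shows "real_chern h x u v = a"
proof -
  have "frechet_derivative (\<lambda>y. fundamental_form h y v w) (at x) u = D u (J v) w" for u v w
    by (simp add: D_def fundamental_form_def)
  \<comment> \<open>In the last two terms \<open>J\<close> occurs twice and disappears, by
    \<open>D_herm\<close> and by \<open>J (J u) = - u\<close>. These terms then cancel against the
    Koszul formula.\<close>
  then have ext: "ext_deriv2 (fundamental_form h) x (J u) v w =
      D (J u) (J v) w + D v w u - D w u v" for w
    using D_herm[of v w u] by (simp add: ext_deriv2_def D_lin)
  show ?thesis
    unfolding real_chern_def
  proof (rule the_equality)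
    show *: "\<forall>w. h x a w = h x (levi_civita h x u v) w
        - 1/2 * ext_deriv2 (fundamental_form h) x (J u) v w"
    proof
      fix w
      show "h x a w = h x (levi_civita h x u v) w
        - 1/2 * ext_deriv2 (fundamental_form h) x (J u) v w"
        unfolding assms koszul ext D_sym[of v u w] by (simp add: field_simps)
    qed
    show "b = a" if b: "\<forall>w. h x b w = h x (levi_civita h x u v) w
        - 1/2 * ext_deriv2 (fundamental_form h) x (J u) v w" for b
      by (rule positive_form_cancel[OF bil[OF S(2)] pos[OF S(2)]])
         (assumption | simp only: b[rule_format] *[rule_format])+
  qed
qed

end

section \<open>Homogeneous metrics on the punctured space\<close>

text \<open>\<open>inner v x\<close> and \<open>inner v (J x)\<close> are the real and the imaginary part of the Hermitian product
  \<open>(v, x)\<close>, linear in \<open>v\<close>.\<close>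

definition hopf_metric :: "real \<Rightarrow> 'n::finite local_metric" where
  "hopf_metric t x v w = t * inner v w / inner x x +
     (inner v x * inner w x + inner v (J x) * inner w (J x)) / (inner x x)\<^sup>2"

text \<open>The complex formula for \<open>\<Gamma>\<close> in real components: \<open>J\<close>
  carries the imaginary parts of \<open>\<zeta>(v) u\<close> and \<open>\<zeta>(u) v\<close>, and
  the last bracket is the complex product \<open>(u, x) (v, x)\<close> acting on
  \<open>x\<close>.\<close>

definition hopf_chern :: "real \<Rightarrow> 'n::finite christoffel" where
  "hopf_chern t x u v =
     inverse (inner x x) *\<^sub>R
       (inverse t *\<^sub>R (inner v x *\<^sub>R u + inner v (J x) *\<^sub>R J u)
        - (inner u x *\<^sub>R v + inner u (J x) *\<^sub>R J v))
     - (inverse t * (inverse (inner x x))\<^sup>2) *\<^sub>R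
       ((inner u x * inner v x - inner u (J x) * inner v (J x)) *\<^sub>R x
        + (inner u x * inner v (J x) + inner u (J x) * inner v x) *\<^sub>R J x)"

lemma bilinear_hopf_metric: "bilinear (hopf_metric t x)"
  unfolding bilinear_def hopf_metric_def
  by (auto intro!: linearI simp: inner_add_left inner_add_right divide_inverse algebra_simps)

lemma hopf_metric_commute: "hopf_metric t x v w = hopf_metric t x w v"
  by (simp add: hopf_metric_def inner_commute[of w v] mult.commute)

lemma hopf_metric_pos:
  assumes "t > 0" "x \<noteq> 0" "v \<noteq> 0"
  shows "hopf_metric t x v v > 0"
  unfolding hopf_metric_def using assms
  by (intro add_pos_nonneg divide_pos_pos mult_pos_pos divide_nonneg_nonneg add_nonneg_nonneg) auto

lemma hopf_metric_complex_struct: "hopf_metric t x (J v) (J w) = hopf_metric t x v w"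
  by (simp add: hopf_metric_def algebra_simps)

lemma smooth_hopf_metric:
  assumes "open S" "0 \<notin> S"
  shows "smooth_fun_on S (\<lambda>x. hopf_metric t x v w)"
proof -
  \<comment> \<open>Moving \<open>J\<close> from \<open>x\<close> to the fixed vectors changes two
    signs, which cancel, and leaves functionals linear in \<open>x\<close>.\<close>
  have "hopf_metric t x v w = t * inner v w * inverse (inner x x) +
      (inner x v * inner x w + inner x (J v) * inner x (J w))
        * (inverse (inner x x) * inverse (inner x x))" for x
    by (simp add: hopf_metric_def divide_inverse power2_eq_square
        inner_commute[of v x] inner_commute[of w x]
        inner_complex_struct_commute[of v x] inner_complex_struct_commute[of w x])
  moreover have "(\<lambda>x. t * inner v w * inverse (inner x x) +
      (inner x v * inner x w + inner x (J v) * inner x (J w))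
        * (inverse (inner x x) * inverse (inner x x))) \<in> radial_rational"
    by (intro radial_rational.intros)
  ultimately show ?thesis using assms by (simp add: smooth_fun_on_radial_rational)
qed

lemma local_hermitian_hopf_metric:
  assumes "t > 0" "open S" "0 \<notin> S"
  shows "local_hermitian_metric S (hopf_metric t)"
  unfolding local_hermitian_metric_def
  using assms by (auto simp: smooth_hopf_metric bilinear_hopf_metric hopf_metric_complex_struct
      intro: hopf_metric_commute intro!: hopf_metric_pos)

text \<open>The coefficients have degree -2 in \<open>x\<close>, which the two scaled vectors
  compensate. At \<open>x = 0\<close> both sides are 0, because division by zero gives 0.\<close>

lemma hopf_metric_scale:
  assumes "c \<noteq> 0"
  shows "hopf_metric t (c *\<^sub>R x) (c *\<^sub>R v) (c *\<^sub>R w) = hopf_metric t x v w"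
  using assms by (cases "x = 0") (auto simp: hopf_metric_def field_simps power2_eq_square)

lemma has_derivative_inner_ident: "((\<lambda>x. inner v x) has_derivative inner v) (at x)"
  by (rule bounded_linear.has_derivative[OF bounded_linear_inner_right has_derivative_ident])

lemma has_derivative_inner_complex_struct:
  "((\<lambda>x. inner v (J x)) has_derivative (\<lambda>u. inner v (J u))) (at x)"
  by (rule bounded_linear.has_derivative[OF bounded_linear_inner_right
        has_derivative_complex_struct[OF has_derivative_ident]])

lemma has_derivative_hopf_metric:
  assumes "x \<noteq> 0"
  shows "((\<lambda>x. hopf_metric t x v w) has_derivative
    (\<lambda>u. - 2 * t * inner v w * inner x u * (inverse (inner x x))\<^sup>2 +
      (inner v u * inner w x + inner v x * inner w u +
       inner v (J u) * inner w (J x) + inner v (J x) * inner w (J u)) * (inverse (inner x x))\<^sup>2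
      - 4 * inner x u * (inner v x * inner w x + inner v (J x) * inner w (J x))
          * (inverse (inner x x)) ^ 3)) (at x)"
proof -
  note d = has_derivative_inverse_inner_self[OF assms]
  have "((\<lambda>x. (t * inner v w) * inverse (inner x x) +
      (inner v x * inner w x + inner v (J x) * inner w (J x))
        * (inverse (inner x x) * inverse (inner x x))) has_derivative
    (\<lambda>u. - 2 * t * inner v w * inner x u * (inverse (inner x x))\<^sup>2 +
      (inner v u * inner w x + inner v x * inner w u +
       inner v (J u) * inner w (J x) + inner v (J x) * inner w (J u)) * (inverse (inner x x))\<^sup>2
      - 4 * inner x u * (inner v x * inner w x + inner v (J x) * inner w (J x))
          * (inverse (inner x x)) ^ 3)) (at x)"
    by (rule has_derivative_eq_rhs,
        (rule has_derivative_const has_derivative_add has_derivative_mult d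
          has_derivative_inner_ident has_derivative_inner_complex_struct)+)
       (simp add: fun_eq_iff algebra_simps power2_eq_square power3_eq_cube)
  then show ?thesis
    by (simp add: hopf_metric_def divide_inverse power2_eq_square)
qed

lemma inner_hopf_chern:
  fixes x u v y :: "complex^'n::finite"
  defines "s \<equiv> inverse (inner x x)"
  shows "inner (hopf_chern t x u v) y =
    s * (inverse t * (inner v x * inner u y - inner v (J x) * inner u (J y))
       - (inner u x * inner v y - inner u (J x) * inner v (J y)))
    - inverse t * s\<^sup>2 *
       ((inner u x * inner v x - inner u (J x) * inner v (J x)) * inner x y
        - (inner u x * inner v (J x) + inner u (J x) * inner v x) * inner x (J y))"
  unfolding hopf_chern_def s_def
  by (simp add: inner_add_left inner_diff_left)

text \<open>Since \<open>\<zeta>(u - \<zeta>(u) x) = 0\<close>, the terms with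
  \<open>inverse t\<close> drop out and
  \<open>\<zeta>(\<Gamma>(u, v)) = - \<zeta>(u) \<zeta>(v)\<close>; these are its real and imaginary
  parts. They collapse the nested Christoffel terms in the curvature.\<close>

lemma inner_hopf_chern_base:
  fixes x u v :: "complex^'n::finite"
  defines "s \<equiv> inverse (inner x x)"
  assumes "x \<noteq> 0"
  shows "inner (hopf_chern t x u v) x =
      - s * (inner u x * inner v x - inner u (J x) * inner v (J x))"
    and "inner (hopf_chern t x u v) (J x) =
      - s * (inner u x * inner v (J x) + inner u (J x) * inner v x)"
proof -
  have s: "s * inner x x = 1" using assms by (simp add: s_def)
  show "inner (hopf_chern t x u v) x =
      - s * (inner u x * inner v x - inner u (J x) * inner v (J x))"
    using s unfolding inner_hopf_chern s_def[symmetric]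
    by (simp add: power2_eq_square) algebra
  show "inner (hopf_chern t x u v) (J x) =
      - s * (inner u x * inner v (J x) + inner u (J x) * inner v x)"
    using s unfolding inner_hopf_chern s_def[symmetric]
    by (simp add: power2_eq_square) algebra
qed

lemma hopf_metric_hopf_chern:
  fixes x u v w :: "complex^'n::finite" and t :: real
  assumes "x \<noteq> 0" "t > 0"
  defines "s \<equiv> inverse (inner x x)"
  shows "hopf_metric t x (hopf_chern t x u v) w =
    (inner w u * inner v x + inner w (J u) * inner v (J x)) * s\<^sup>2
    - t * s\<^sup>2 * (inner x u * inner v w + inner u (J x) * inner w (J v))
    - 2 * s ^ 3 * ((inner x u * inner v x - inner u (J x) * inner v (J x)) * inner w x
        + (inner x u * inner v (J x) + inner u (J x) * inner v x) * inner w (J x))"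
proof -
  \<comment> \<open>The relation between \<open>s\<close> and \<open>inner x x\<close> is already
    absorbed in \<open>inner_hopf_chern_base\<close>, so this is the relation that the ring identity
    takes as its hypothesis.\<close>
  have "t * inverse t = 1" using \<open>t > 0\<close> by simp
  then show ?thesis
    unfolding hopf_metric_def divide_inverse power_inverse[symmetric] inner_hopf_chern_base[OF \<open>x \<noteq> 0\<close>]
    unfolding inner_hopf_chern s_def[symmetric] inner_commute[of w u] inner_commute[of x u] inner_commute[of w x]
      inner_complex_struct_commute[of w u] inner_complex_struct_commute[of w v]
      inner_complex_struct_commute[of w x]
    by algebra
qed

lemma real_chern_hopf_metric:
  assumes "t > 0" "x \<noteq> 0"
  shows "real_chern (hopf_metric t) x u v = hopf_chern t x u v"
proof -
  \<comment> \<open>The connection at \<open>x\<close> depends on the metric near \<open>x\<close>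
    only, so the whole punctured space can serve as the open set.\<close>
  interpret hermitian_at "hopf_metric t" "- {0}" x
    by unfold_locales (use assms in \<open>auto intro!: local_hermitian_hopf_metric\<close>)
  have D: "D u v w = - 2 * t * inner v w * inner x u * (inverse (inner x x))\<^sup>2 +
      (inner v u * inner w x + inner v x * inner w u +
       inner v (J u) * inner w (J x) + inner v (J x) * inner w (J u)) * (inverse (inner x x))\<^sup>2
      - 4 * inner x u * (inner v x * inner w x + inner v (J x) * inner w (J x))
          * (inverse (inner x x)) ^ 3" for u v w
    by (rule D_eqI[OF has_derivative_hopf_metric[OF assms(2)]]) simp
  have "hopf_metric t x (hopf_chern t x u v) w = 1/2 * (D u v w - D (J u) (J v) w)" for w
    by (simp add: hopf_metric_hopf_chern assms D inner_complex_struct_commute[of x u]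
          inner_complex_struct_commute[of v w] inner_commute[of v w] inner_commute[of u w]
          inner_commute[of u x] algebra_simps)
  then show ?thesis by (rule real_chern_eqI)
qed

section \<open>Derivative of the Christoffel map and the curvature\<close>

definition hopf_chern_deriv ::
    "real \<Rightarrow> complex^'n::finite \<Rightarrow> complex^'n \<Rightarrow> complex^'n \<Rightarrow> complex^'n \<Rightarrow> complex^'n" where
  "hopf_chern_deriv t x u v w =
    (let s = inverse (inner x x); ds = - 2 * inner x u * s\<^sup>2 in
     s *\<^sub>R (inverse t *\<^sub>R (inner w u *\<^sub>R v + inner w (J u) *\<^sub>R J v)
        - (inner v u *\<^sub>R w + inner v (J u) *\<^sub>R J w))
     + ds *\<^sub>R (inverse t *\<^sub>R (inner w x *\<^sub>R v + inner w (J x) *\<^sub>R J v)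
        - (inner v x *\<^sub>R w + inner v (J x) *\<^sub>R J w))
     - (inverse t * s\<^sup>2) *\<^sub>R
       ((inner v x * inner w x - inner v (J x) * inner w (J x)) *\<^sub>R u
        + (inner v u * inner w x + inner v x * inner w u
           - inner v (J u) * inner w (J x) - inner v (J x) * inner w (J u)) *\<^sub>R x
        + (inner v x * inner w (J x) + inner v (J x) * inner w x) *\<^sub>R J u
        + (inner v u * inner w (J x) + inner v x * inner w (J u)
           + inner v (J u) * inner w x + inner v (J x) * inner w u) *\<^sub>R J x)
     - (2 * inverse t * s * ds) *\<^sub>R
       ((inner v x * inner w x - inner v (J x) * inner w (J x)) *\<^sub>R x
        + (inner v x * inner w (J x) + inner v (J x) * inner w x) *\<^sub>R J x))"

lemma has_derivative_hopf_chern: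
  fixes x :: "complex^'n::finite"
  assumes "x \<noteq> 0"
  shows "((\<lambda>x. hopf_chern t x v w) has_derivative (\<lambda>u. hopf_chern_deriv t x u v w)) (at x)"
  unfolding hopf_chern_def power2_eq_square
  by (rule has_derivative_eq_rhs,
      (rule has_derivative_const has_derivative_add has_derivative_diff has_derivative_scaleR
        has_derivative_mult has_derivative_inverse_inner_self[OF assms] has_derivative_ident
        has_derivative_inner_ident has_derivative_inner_complex_struct has_derivative_complex_struct)+)
     (simp add: fun_eq_iff hopf_chern_deriv_def Let_def algebra_simps power2_eq_square)

text \<open>This is \<open>u - \<zeta>(u) x\<close>, the Euclidean projection onto the orthogonal
  complement of the complex line through \<open>x\<close>.\<close>

definition transversal :: "complex^'n::finite \<Rightarrow> complex^'n \<Rightarrow> complex^'n" where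
  "transversal x u = u - inverse (inner x x) *\<^sub>R (inner u x *\<^sub>R x + inner u (J x) *\<^sub>R J x)"

lemma inner_transversal_base:
  assumes "x \<noteq> 0"
  shows "inner (transversal x u) x = 0" "inner (transversal x u) (J x) = 0"
  using assms by (simp_all add: transversal_def inner_add_left inner_diff_left)

lemma inner_transversal_transversal:
  "x \<noteq> 0 \<Longrightarrow> inner (transversal x u) (transversal x p) = inner (transversal x u) p"
  by (subst (2) transversal_def)
     (simp add: inner_transversal_base inner_diff_right inner_add_right)

text \<open>Once \<open>inner_hopf_chern_base\<close> has contracted the nested terms, both sides
  are polynomials in real inner products, \<open>s\<close> and \<open>inverse t\<close>. The
  right-hand side is arranged as a quadratic form in \<open>e\<close>, so that tracing it needs only
  sums of products \<open>inner e p * inner e q\<close> and of \<open>inner e e\<close>.\<close>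

lemma hopf_curvature:
  fixes x u e p :: "complex^'n::finite"
  defines "s \<equiv> inverse (inner x x)"
  defines "U \<equiv> transversal x u" and "P \<equiv> transversal x p"
  assumes "x \<noteq> 0"
  shows "inner (hopf_chern_deriv t x u e e - hopf_chern_deriv t x e u e
      + hopf_chern t x u (hopf_chern t x e e) - hopf_chern t x e (hopf_chern t x u e)) p =
    s * (2 * (inner e (J U) * inner e (J p))
      + inverse t * (inner e U * inner e P - inner e (J U) * inner e (J P))
      - inverse t * (inner e e - s * (inner e x * inner e x + inner e (J x) * inner e (J x))) * inner U p
      - 2 * inverse t * s * (inner e (J U) *
          inner e (inner p (J x) *\<^sub>R x - inner p x *\<^sub>R J x)))"
  unfolding U_def P_def hopf_chern_deriv_def Let_def transversal_def
    inner_diff_left inner_add_left inner_diff_right inner_add_right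
    inner_hopf_chern[of t x u] inner_hopf_chern[of t x e "hopf_chern t x u e"]
    inner_hopf_chern_base[OF \<open>x \<noteq> 0\<close>] s_def[symmetric]
  by (simp add: inner_add_left inner_diff_left inner_add_right inner_diff_right
      inner_hopf_chern s_def[symmetric]
      inner_commute[of x e] inner_commute[of x u] inner_commute[of x p] inner_commute[of e u]
      inner_complex_struct_commute[of x e] inner_complex_struct_commute[of x u]
      inner_complex_struct_commute[of x p] inner_complex_struct_commute[of e u])
    (simp add: algebra_simps power2_eq_square)

section \<open>Sums over orthonormal frames and the Ricci curvature\<close>

text \<open>Orthonormal vectors are independent, so by their number they span. The remainder of the
  expansion is orthogonal to all of them, hence to itself.\<close>

lemma orthonormal_expansion:
  fixes B :: "'a::euclidean_space \<Rightarrow> 'a \<Rightarrow> real"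
  assumes B: "bilinear B" and pos: "\<And>v. v \<noteq> 0 \<Longrightarrow> B v v > 0"
    and I: "card I = DIM('a)"
    and e: "\<And>i j. i \<in> I \<Longrightarrow> j \<in> I \<Longrightarrow> B (e i) (e j) = (if i = j then 1 else 0)"
  shows "p = (\<Sum>i\<in>I. B p (e i) *\<^sub>R e i)"
proof -
  have fin: "finite I" using I by (metis DIM_positive card.infinite less_irrefl)
  have Bsum: "B (\<Sum>i\<in>A. c i *\<^sub>R e i) w = (\<Sum>i\<in>A. c i * B (e i) w)" for A :: "'b set" and c w
    using B unfolding bilinear_def
    by (simp add: linear_sum[of "\<lambda>v. B v w"] linear_scale[of "\<lambda>v. B v w"])
  have inj: "inj_on e I"
    by (rule inj_onI) (metis e zero_neq_one)
  have "independent (e ` I)"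
  proof (rule independent_if_scalars_zero)
    show "finite (e ` I)" using fin by simp
    fix f v assume f: "(\<Sum>v\<in>e ` I. f v *\<^sub>R v) = 0" and "v \<in> e ` I"
    then obtain j where j: "j \<in> I" "v = e j" by blast
    have "0 = B (\<Sum>i\<in>I. f (e i) *\<^sub>R e i) (e j)"
      using f bilinear_lzero[OF B] by (simp add: sum.reindex[OF inj])
    also have "\<dots> = (\<Sum>i\<in>I. if i = j then f (e i) else 0)"
      unfolding Bsum by (rule sum.cong) (simp_all add: e j)
    also have "\<dots> = f v" using j fin by (simp add: sum.delta)
    finally show "f v = 0" by simp
  qed
  then have span: "span (e ` I) = UNIV"
    using card_ge_dim_independent[of "e ` I" UNIV] by (auto simp: card_image[OF inj] I)
  have "B (p - (\<Sum>i\<in>I. B p (e i) *\<^sub>R e i)) w = 0" for w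
  proof -
    have "w \<in> span (e ` I)" using span by simp
    then show ?thesis
    proof (induction rule: span_induct)
      case base
      show ?case using B by (auto simp: subspace_def bilinear_rzero bilinear_radd bilinear_rmul)
    next
      case (step w)
      then obtain j where j: "j \<in> I" "w = e j" by blast
      have "B (\<Sum>i\<in>I. B p (e i) *\<^sub>R e i) (e j) = (\<Sum>i\<in>I. if i = j then B p (e i) else 0)"
        unfolding Bsum by (rule sum.cong) (simp_all add: e j)
      then show ?case using j fin by (simp add: bilinear_lsub[OF B] sum.delta)
    qed
  qed
  then show ?thesis
    using pos by (metis eq_iff_diff_eq_0 less_irrefl)
qed

lemma orthonormal_parseval:
  fixes B :: "'a::euclidean_space \<Rightarrow> 'a \<Rightarrow> real"
  assumes "bilinear B" "\<And>v. v \<noteq> 0 \<Longrightarrow> B v v > 0" "card I = DIM('a)"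
    and "\<And>i j. i \<in> I \<Longrightarrow> j \<in> I \<Longrightarrow> B (e i) (e j) = (if i = j then 1 else 0)"
  shows "(\<Sum>i\<in>I. B p (e i) * B (e i) q) = B p q"
proof -
  have "B p q = B (\<Sum>i\<in>I. B p (e i) *\<^sub>R e i) q"
    using orthonormal_expansion[OF assms, of p] by simp
  also have "\<dots> = (\<Sum>i\<in>I. B p (e i) * B (e i) q)"
    using assms(1) unfolding bilinear_def
    by (simp add: linear_sum[of "\<lambda>v. B v q"] linear_scale[of "\<lambda>v. B v q"])
  finally show ?thesis by simp
qed

text \<open>Index raising. Relative to the Euclidean product the metric is
  \<open>(t + 1) / |x|^2\<close> on the complex line through \<open>x\<close> and
  \<open>t / |x|^2\<close> across it; the correction comes from
  \<open>1/t - 1/(t + 1) = 1/(t * (t + 1))\<close>.\<close>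

definition hopf_sharp :: "real \<Rightarrow> complex^'n::finite \<Rightarrow> complex^'n \<Rightarrow> complex^'n" where
  "hopf_sharp t x p = (inner x x / t) *\<^sub>R p
     - inverse (t * (t + 1)) *\<^sub>R (inner p x *\<^sub>R x + inner p (J x) *\<^sub>R J x)"

lemma hopf_metric_sharp:
  assumes "t > 0" "x \<noteq> 0"
  shows "hopf_metric t x (hopf_sharp t x p) q = inner p q"
proof -
  define s where "s = inverse (inner x x)"
  have s: "s * inner x x = 1" using assms by (simp add: s_def)
  define k where "k = inverse (t * (t + 1))"
  have t: "t * inverse t = 1" "k * (t * (t + 1)) = 1"
    using assms by (simp_all add: k_def del: inverse_mult_distrib)
  have qx: "inner x q = inner q x" "inner x (J q) = - inner q (J x)"
    by (rule inner_commute inner_complex_struct_commute)+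
  show ?thesis
    using s t unfolding hopf_metric_def divide_inverse hopf_sharp_def power_inverse[symmetric]
      s_def[symmetric] k_def[symmetric]
    by (simp add: inner_diff_left inner_add_left qx power2_eq_square) algebra
qed

text \<open>\<open>hopf_sharp\<close> turns Euclidean products with the frame into metric ones, to
  which the Parseval identity applies.\<close>

lemma hopf_frame_sum:
  fixes x :: "complex^'n::finite"
  assumes "t > 0" "x \<noteq> 0" "orthonormal_frame (hopf_metric t) x e"
  shows "(\<Sum>i < 2 * CARD('n). inner (e i) p * inner (e i) q) =
    inner x x / t * inner p q
      - inverse (t * (t + 1)) * (inner p x * inner q x + inner p (J x) * inner q (J x))"
proof -
  have "(\<Sum>i < 2 * CARD('n). hopf_metric t x (hopf_sharp t x p) (e i)
      * hopf_metric t x (e i) (hopf_sharp t x q)) = hopf_metric t x (hopf_sharp t x p) (hopf_sharp t x q)"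
    by (rule orthonormal_parseval)
       (use assms in \<open>auto simp: bilinear_hopf_metric hopf_metric_pos orthonormal_frame_def\<close>)
  moreover have "hopf_metric t x (e i) (hopf_sharp t x q) = inner (e i) q" for i
    by (simp add: hopf_metric_commute[of t x "e i"] hopf_metric_sharp[OF assms(1,2)] inner_commute)
  moreover have "hopf_metric t x (hopf_sharp t x p) (e i) = inner (e i) p" for i
    by (simp add: hopf_metric_sharp[OF assms(1,2)] inner_commute)
  moreover have "hopf_metric t x (hopf_sharp t x p) (hopf_sharp t x q) = inner x x / t * inner p q
      - inverse (t * (t + 1)) * (inner p x * inner q x + inner p (J x) * inner q (J x))"
    unfolding hopf_metric_sharp[OF assms(1,2)]
    unfolding hopf_sharp_def inner_diff_right inner_add_right inner_scaleR_right
    by (simp only: mult.commute)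
  ultimately show ?thesis by (simp only:)
qed

text \<open>Each squared norm is expanded in the standard basis, which has
  \<open>2 * CARD('n)\<close> real elements, and the sums are exchanged.\<close>

lemma hopf_frame_sum_self:
  fixes x :: "complex^'n::finite"
  assumes "t > 0" "x \<noteq> 0" "orthonormal_frame (hopf_metric t) x e"
  shows "(\<Sum>i < 2 * CARD('n). inner (e i) (e i)) =
    2 * CARD('n) * inner x x / t - 2 * inverse (t * (t + 1)) * inner x x"
proof -
  have parseval: "(\<Sum>b\<in>Basis. inner y b * inner y b) = inner y y" for y :: "complex^'n"
    using euclidean_inner[of y y] by simp
  have "(\<Sum>i < 2 * CARD('n). inner (e i) (e i)) =
      (\<Sum>b\<in>Basis. \<Sum>i < 2 * CARD('n). inner (e i) b * inner (e i) b)"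
    by (subst sum.swap) (simp add: parseval)
  also have "\<dots> = (\<Sum>b\<in>Basis. inner x x / t
      - inverse (t * (t + 1)) * (inner x b * inner x b + inner (J x) b * inner (J x) b))"
    unfolding hopf_frame_sum[OF assms]
  proof (rule sum.cong)
    fix b :: "complex^'n" assume "b \<in> Basis"
    then show "inner x x / t * inner b b
        - inverse (t * (t + 1)) * (inner b x * inner b x + inner b (J x) * inner b (J x)) =
      inner x x / t
        - inverse (t * (t + 1)) * (inner x b * inner x b + inner (J x) b * inner (J x) b)"
      by (simp only: inner_commute[of b x] inner_commute[of b "J x"] inner_same_Basis mult_1_right)
  qed simp
  also have "\<dots> = 2 * CARD('n) * inner x x / t - 2 * inverse (t * (t + 1)) * inner x x"
    unfolding sum_subtractf sum_distrib_left[symmetric] sum.distrib parseval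
    by simp
  finally show ?thesis .
qed

text \<open>With \<open>U\<close> the transversal part of \<open>u\<close>, the first term of
  \<open>hopf_curvature\<close> contributes \<open>2/t * inner U p\<close>. The second vanishes
  because \<open>J\<close> is an isometry, the last because \<open>J U\<close> is orthogonal to
  \<open>x\<close> and \<open>J x\<close>. In the third, removing the complex line leaves
  \<open>n - 1\<close> complex directions, which gives
  \<open>- 2 * (n - 1) / t^2 * inner U p\<close>.\<close>

lemma hopf_curvature_sum:
  fixes x u p :: "complex^'n::finite"
  assumes "t > 0" "x \<noteq> 0" "orthonormal_frame (hopf_metric t) x e"
  shows "(\<Sum>i < 2 * CARD('n).
      inner (hopf_chern_deriv t x u (e i) (e i) - hopf_chern_deriv t x (e i) u (e i)
        + hopf_chern t x u (hopf_chern t x (e i) (e i))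
        - hopf_chern t x (e i) (hopf_chern t x u (e i))) p) =
    2 / t * (1 - (real CARD('n) - 1) / t) * inner (transversal x u) p"
proof -
  define s U P where "s = inverse (inner x x)" and "U = transversal x u" and "P = transversal x p"
  note base = inner_transversal_base[OF assms(2)]
  note G = hopf_frame_sum[OF assms]
  have U: "inner U x = 0" "inner U (J x) = 0" "inner P x = 0" "inner P (J x) = 0"
    "inner U P = inner U p"
    unfolding U_def P_def using assms(2) by (simp_all add: base inner_transversal_transversal)
  have nz: "inner x x \<noteq> 0" using assms(2) by simp
  show ?thesis
    unfolding hopf_curvature[OF assms(2)] sum_distrib_left[symmetric] sum.distrib sum_subtractf
      sum_distrib_right[symmetric] G hopf_frame_sum_self[OF assms] U_def[symmetric] P_def[symmetric]
    using nz assms(1)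
    by (simp add: U inner_diff_right inner_add_right) (simp add: field_simps)
qed

lemma ricci_hopf_metric:
  fixes x u v :: "complex^'n::finite"
  assumes "t > 0" "x \<noteq> 0" "orthonormal_frame (hopf_metric t) x e"
  shows "ricci (hopf_metric t) (real_chern (hopf_metric t)) x e u v =
    2 / t * (1 - (real CARD('n) - 1) / t) * hopf_metric t x (transversal x u) v"
proof -
  let ?\<Gamma> = "real_chern (hopf_metric t) :: 'n christoffel"
  \<comment> \<open>The Euclidean gradient of the functional \<open>hopf_metric t x _ v\<close>,
    which brings the curvature into the form of \<open>hopf_curvature_sum\<close>.\<close>
  define p where "p = inverse (inner x x) *\<^sub>R
    (t *\<^sub>R v + inverse (inner x x) *\<^sub>R (inner v x *\<^sub>R x + inner v (J x) *\<^sub>R J x))"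
  have p: "hopf_metric t x y v = inner y p" for y
    by (simp add: p_def hopf_metric_def inner_add_right divide_inverse power2_eq_square algebra_simps)
  \<comment> \<open>This disposes of the bracket term: constant fields commute.\<close>
  have zero: "hopf_chern t x 0 w = 0" for w :: "complex^'n"
    by (simp add: hopf_chern_def)
  have deriv: "frechet_derivative (\<lambda>y. ?\<Gamma> y b c) (at x) a = hopf_chern_deriv t x a b c" for a b c
  proof -
    have "((\<lambda>y. ?\<Gamma> y b c) has_derivative (\<lambda>u. hopf_chern_deriv t x u b c)) (at x)"
      by (rule has_derivative_transform_within_open[OF has_derivative_hopf_chern[OF assms(2)], of "- {0}"])
         (use assms in \<open>auto simp: real_chern_hopf_metric\<close>)
    from fun_cong[OF frechet_derivative_at[OF this]] show ?thesis by simp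
  qed
  have "curvature_at (hopf_metric t) ?\<Gamma> x a b c v =
      inner (hopf_chern_deriv t x a b c - hopf_chern_deriv t x b a c
        + hopf_chern t x a (hopf_chern t x b c) - hopf_chern t x b (hopf_chern t x a c)) p" for a b c
    by (simp add: curvature_at_def curvature_def cov_deriv_def lie_bracket_def deriv p
        real_chern_hopf_metric assms(1,2) zero inner_diff_left inner_add_left)
  then show ?thesis
    unfolding ricci_def by (simp only: hopf_curvature_sum[OF assms] p)
qed

section \<open>Descent to the Hopf manifold\<close>

text \<open>The power of 1/2 depends on the point, but the one found at \<open>x\<close> works on a
  whole neighbourhood, so near \<open>x\<close> the transition is linear and equals its
  derivative.\<close>

lemma transition_hopf:
  fixes c d :: "((complex^'n::finite) set, 'n) chart"
  assumes "c \<in> hopf_atlas" "d \<in> hopf_atlas" "x \<in> snd c ` (fst c \<inter> fst d)"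
  obtains a :: real where "a \<noteq> 0" "transition c d x = a *\<^sub>R x"
    "(transition c d has_derivative (\<lambda>v. a *\<^sub>R v)) (at x)"
proof -
  obtain V where V: "open V" "inj_on hopf_orbit V"
      and c: "c = (hopf_orbit ` V, inv_into V hopf_orbit)"
    using assms(1) unfolding hopf_atlas_def by blast
  obtain W where W: "open W" "inj_on hopf_orbit W"
      and d: "d = (hopf_orbit ` W, inv_into W hopf_orbit)"
    using assms(2) unfolding hopf_atlas_def by blast
  obtain y w where yw: "y \<in> V" "w \<in> W" "hopf_orbit y = hopf_orbit w"
      "x = inv_into V hopf_orbit (hopf_orbit y)"
    using assms(3) unfolding c d by auto
  have "x = y" using inv_into_f_f[OF V(2) yw(1)] yw(4) by simp
  then obtain k :: int where k: "w = ((1/2) powi k) *\<^sub>R x"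
    using yw(3) unfolding \<open>x = y\<close> hopf_orbit_eq_iff by blast
  define a :: real where "a = (1/2) powi k"
  have tr: "transition c d z = a *\<^sub>R z" if "z \<in> V" "a *\<^sub>R z \<in> W" for z
  proof -
    have "inv_into (fst c) (snd c) z = inv_into (fst c) (snd c) (snd c (hopf_orbit z))"
      using that(1) V(2) by (simp add: c)
    also have "\<dots> = hopf_orbit z"
      by (rule inv_into_f_f) (use that(1) in \<open>auto simp: c inj_on_inv_into\<close>)
    also have "\<dots> = hopf_orbit (a *\<^sub>R z)"
      unfolding hopf_orbit_eq_iff a_def by blast
    finally show ?thesis using that(2) W(2) by (simp add: transition_def d)
  qed
  have x: "x \<in> V" "a *\<^sub>R x \<in> W"
    using yw(1,2) unfolding \<open>x = y\<close> k a_def by this+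
  have op: "open (V \<inter> (\<lambda>z. a *\<^sub>R z) -` W)"
    by (intro open_Int V open_vimage W continuous_intros)
  have "((\<lambda>z. a *\<^sub>R z) has_derivative (\<lambda>v. a *\<^sub>R v)) (at x)"
    by (intro has_derivative_scaleR_right has_derivative_ident)
  then have "(transition c d has_derivative (\<lambda>v. a *\<^sub>R v)) (at x)"
    by (rule has_derivative_transform_within_open[OF _ op]) (use x in \<open>simp_all add: tr\<close>)
  moreover have "a \<noteq> 0" by (simp add: a_def)
  ultimately show thesis using tr[OF x] by (intro that)
qed

lemma hopf_chart_image:
  assumes "c \<in> hopf_atlas"
  shows "open (snd c ` fst c)" "0 \<notin> snd c ` fst c"
proof -
  obtain V where V: "open V" "V \<subseteq> UNIV - {0}" "inj_on hopf_orbit V"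
      and c: "c = (hopf_orbit ` V, inv_into V hopf_orbit)"
    using assms unfolding hopf_atlas_def by blast
  have "snd c ` fst c = V" using V(3) by (auto simp: c image_image)
  then show "open (snd c ` fst c)" "0 \<notin> snd c ` fst c" using V by auto
qed

lemma hermitian_hopf_metric:
  assumes "t > 0"
  shows "hermitian_metric hopf_atlas (\<lambda>_. hopf_metric t)"
  unfolding hermitian_metric_def
proof (intro conjI ballI allI)
  fix c :: "((complex^'n) set, 'n) chart" assume c: "c \<in> hopf_atlas"
  show "local_hermitian_metric (snd c ` fst c) (hopf_metric t)"
    by (rule local_hermitian_hopf_metric[OF assms hopf_chart_image[OF c]])
  fix d :: "((complex^'n) set, 'n) chart" and x v w
  assume "d \<in> hopf_atlas" "x \<in> snd c ` (fst c \<inter> fst d)"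
  then obtain a :: real where a: "a \<noteq> 0" "transition c d x = a *\<^sub>R x"
    "(transition c d has_derivative (\<lambda>v. a *\<^sub>R v)) (at x)"
    using transition_hopf c by blast
  show "hopf_metric t x v w = hopf_metric t (transition c d x)
      (frechet_derivative (transition c d) (at x) v) (frechet_derivative (transition c d) (at x) w)"
    unfolding frechet_derivative_at[OF a(3), symmetric] a(2) hopf_metric_scale[OF a(1)] ..
qed

theorem theorem1p5:
  assumes "CARD('n::finite) \<ge> 2"
  shows "\<exists>g :: ((complex^'n) set, 'n) chart \<Rightarrow> 'n local_metric.
    hermitian_metric hopf_atlas g \<and> real_chern_ricci_flat hopf_atlas g"
proof -
  \<comment> \<open>This value annihilates the factor in \<open>ricci_hopf_metric\<close>; it is
    positive because the complex dimension is at least 2.\<close>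
  define t where "t = real CARD('n) - 1"
  have t: "t > 0" using assms by (simp add: t_def)
  have "real_chern_ricci_flat hopf_atlas (\<lambda>_ :: ((complex^'n) set, 'n) chart. hopf_metric t)"
    unfolding real_chern_ricci_flat_def
  proof (intro ballI allI impI)
    fix c :: "((complex^'n) set, 'n) chart" and x :: "complex^'n" and e u v
    assume "c \<in> hopf_atlas" "x \<in> snd c ` fst c" and e: "orthonormal_frame (hopf_metric t) x e"
    then have "x \<noteq> 0" using hopf_chart_image(2) by blast
    from ricci_hopf_metric[OF t this e]
    show "ricci (hopf_metric t) (real_chern (hopf_metric t)) x e u v = 0"
      using t by (simp add: t_def)
  qed
  then show ?thesis using hermitian_hopf_metric[OF t] by blast
qed

end
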